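(* Let $k\ge 3$ be a constant integer and let $f(n)=o(\log\log n)$ be an arbitrary function with $f(n)\to\infty$. Let $A(n)$ be a random $k$-Apollonian network on $n+k$ vertices, and suppose that initially a vertex of $A(n)$ chosen uniformly at random knows a rumor. Then there is a constant $C>0$ such that, with probability $1-o(1)$ as $n\to\infty$, after $C\,(\log n)^{(k^2-3)/(k-1)^2}\cdot\log\log n\cdot f(n)^{2/k}$ rounds of the Push-Pull protocol, at least $n-o(n)$ vertices know the rumor.
   Context: Random $k$-Apollonian process: $A(0)$ is a clique on $k$ vertices, marked active. For $t=1,\dots,n$, $A(t)$ is obtained from $A(t-1)$ by choosing an active $k$-clique of $A(t-1)$ uniformly at random, creating a new vertex joined to all $k$ vertices of that clique; the chosen clique is marked non-active and the $k$ new $k$-cliques containing the new vertex are marked active. $A(n)$ is a random $k$-Apollonian network on $n+k$ vertices. Push-Pull protocol: in synchronous rounds, every informed vertex contacts a uniformly random neighbor and sends it the rumor, and every uninformed vertex contacts a uniformly random neighbor and receives the rumor if that neighbor knows it; all random choices are independent, and a vertex informed in a round cannot forward the rumor in that same round. *)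

theory Defs
  imports "HOL-Probability.Probability" "HOL-Library.Landau_Symbols"
begin

text \<open>Random k-Apollonian process. Vertices are natural numbers; A(t) has vertex set
  {0..<k+t}. A state is a pair (E, Act): E is the edge set (edges are 2-element sets),
  Act is the set of active k-cliques (each a k-element vertex set).
  A(0) is the clique on {0..<k}, marked active. In step t+1 the new vertex is k+t.\<close>

definition apollonian_init :: "nat \<Rightarrow> nat set set \<times> nat set set" where
  "apollonian_init k = ({{u, w} | u w. u < k \<and> w < k \<and> u \<noteq> w}, {{0..<k}})"

definition apollonian_step :: "nat \<Rightarrow> nat set set \<times> nat set set \<Rightarrow> (nat set set \<times> nat set set) pmf" where
  "apollonian_step v S =
     map_pmf (\<lambda>c. (fst S \<union> {{v, u} | u. u \<in> c},
                   (snd S - {c}) \<union> (\<lambda>u. insert v (c - {u})) ` c))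
             (pmf_of_set (snd S))"

fun apollonian :: "nat \<Rightarrow> nat \<Rightarrow> (nat set set \<times> nat set set) pmf" where
  "apollonian k 0 = return_pmf (apollonian_init k)"
| "apollonian k (Suc t) = bind_pmf (apollonian k t) (apollonian_step (k + t))"

definition apollonian_network :: "nat \<Rightarrow> nat \<Rightarrow> nat set set pmf" where
  "apollonian_network k n = map_pmf fst (apollonian k n)"

definition nbrs :: "nat set set \<Rightarrow> nat \<Rightarrow> nat set" where
  "nbrs E v = {u. {v, u} \<in> E \<and> u \<noteq> v}"

definition push_pull_round :: "nat set \<Rightarrow> nat set set \<Rightarrow> nat set \<Rightarrow> nat set pmf" where
  "push_pull_round V E I =
     map_pmf (\<lambda>N. I \<union> N ` I \<union> {u \<in> V. N u \<in> I})
             (Pi_pmf V 0 (\<lambda>v. pmf_of_set (nbrs E v)))"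

definition push_pull :: "nat set \<Rightarrow> nat set set \<Rightarrow> nat \<Rightarrow> nat set \<Rightarrow> nat set pmf" where
  "push_pull V E t I0 = ((\<lambda>p. bind_pmf p (push_pull_round V E)) ^^ t) (return_pmf I0)"

definition apollonian_rumor :: "nat \<Rightarrow> nat \<Rightarrow> nat \<Rightarrow> nat set pmf" where
  "apollonian_rumor k n t =
     bind_pmf (apollonian_network k n) (\<lambda>E.
       bind_pmf (pmf_of_set {0..<n + k}) (\<lambda>v. push_pull {0..<n + k} E t {v}))"

end

theory Submission
  imports Defs "HOL-Real_Asymp.Real_Asymp"
begin

text \<open>Attach every new vertex to the youngest vertex of its clique; this gives a tree rooted at
  \<open>k - 1\<close>. Crossing the tree edge from \<open>y\<close> to its parent is cheap via the relay of \<open>y\<close>, the youngest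
  common neighbour of the two (or \<open>y\<close> itself): in expectation it takes a number of rounds at most twice
  the degree of the relay, which in turn is at most the number \<open>D y\<close> of active cliques containing it.
  Since at least \<open>k - 1\<close> active cliques contain \<open>y\<close> and its parent, the relay is renewed, with \<open>D\<close>
  reset to \<open>k\<close>, faster than its degree grows. Let \<open>M y\<close> be the number of active cliques below \<open>y\<close>.
  One step of the process changes \<open>\<Sum>y. M y * D y\<close> in expectation by a factor of at most
  \<open>1 + (k - 2) / a\<close>, where \<open>a\<close> is the number of active cliques, plus a term \<open>O((\<Sum>y. M y) / a + 1)\<close>.
  As \<open>\<Sum>y. M y\<close> has expectation \<open>O(n log n)\<close>, so has \<open>\<Sum>y. M y * D y\<close>. Hence a typical vertex
  is at expected distance \<open>O(log n)\<close> from the root, and the rumour needs only \<open>O(log n)\<close> rounds times an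
  arbitrarily slowly growing function, which is within the claimed bound.\<close>

section \<open>Histories of the process\<close>

text \<open>A history lists the chosen cliques, newest first.\<close>

fun active :: "nat \<Rightarrow> nat set list \<Rightarrow> nat set set" where
  "active k [] = {{0..<k}}"
| "active k (c # h) = (active k h - {c}) \<union> (\<lambda>u. insert (k + length h) (c - {u})) ` c"

fun edges :: "nat \<Rightarrow> nat set list \<Rightarrow> nat set set" where
  "edges k [] = {{u, w} | u w. u < k \<and> w < k \<and> u \<noteq> w}"
| "edges k (c # h) = edges k h \<union> {{k + length h, u} | u. u \<in> c}"

fun valid :: "nat \<Rightarrow> nat set list \<Rightarrow> bool" where
  "valid k [] \<longleftrightarrow> True"
| "valid k (c # h) \<longleftrightarrow> c \<in> active k h \<and> valid k h"

text \<open>On the initial vertices \<open>parent\<close> and \<open>relay\<close> carry no information and \<open>ancestors\<close> is empty;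
  the root \<open>k - 1\<close> is not listed among the ancestors.\<close>

fun parent :: "nat \<Rightarrow> nat set list \<Rightarrow> nat \<Rightarrow> nat" where
  "parent k [] y = 0"
| "parent k (c # h) y = (if y = k + length h then Max c else parent k h y)"

fun ancestors :: "nat \<Rightarrow> nat set list \<Rightarrow> nat \<Rightarrow> nat set" where
  "ancestors k [] y = {}"
| "ancestors k (c # h) y =
    (if y = k + length h then insert y (ancestors k h (Max c)) else ancestors k h y)"

fun relay :: "nat \<Rightarrow> nat set list \<Rightarrow> nat \<Rightarrow> nat" where
  "relay k [] y = y"
| "relay k (c # h) y =
    (if y = k + length h \<or> {y, parent k h y} \<subseteq> c then k + length h else relay k h y)"

definition count_active :: "nat \<Rightarrow> nat set list \<Rightarrow> (nat set \<Rightarrow> bool) \<Rightarrow> nat" where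
  "count_active k h P = card {c \<in> active k h. P c}"

text \<open>This is \<open>M y\<close>. A clique lies below \<open>y\<close> when its youngest
  vertex does, since that vertex becomes the parent of any vertex inserted into the clique.\<close>

definition mass :: "nat \<Rightarrow> nat set list \<Rightarrow> nat \<Rightarrow> nat" where
  "mass k h y = count_active k h (\<lambda>c. y \<in> ancestors k h (Max c))"

text \<open>This is \<open>D y\<close>. Active cliques stand in for the degree of the relay because
  the process selects a vertex with probability proportional to them.\<close>

definition weight :: "nat \<Rightarrow> nat set list \<Rightarrow> nat \<Rightarrow> nat" where
  "weight k h y = count_active k h (\<lambda>c. relay k h y \<in> c)"

definition total_mass :: "nat \<Rightarrow> nat set list \<Rightarrow> real" where
  "total_mass k h = (\<Sum>y = k..<k + length h. real (mass k h y))"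

definition potential :: "nat \<Rightarrow> nat set list \<Rightarrow> real" where
  "potential k h = (\<Sum>y = k..<k + length h. real (mass k h y) * real (weight k h y))"

section \<open>Active cliques: size, youngest vertex and counting\<close>

lemma active_clique:
  assumes "valid k h" "c \<in> active k h"
  shows "c \<subseteq> {0..<k + length h}" "finite c" "card c = k"
proof -
  have "c \<subseteq> {0..<k + length h} \<and> finite c \<and> card c = k"
    using assms
  proof (induction h arbitrary: c)
    case (Cons b h)
    have b: "b \<subseteq> {0..<k + length h}" "finite b" "card b = k"
      using Cons.IH[of b] Cons.prems by auto
    from Cons.prems(2) consider "c \<in> active k h"
      | u where "u \<in> b" "c = insert (k + length h) (b - {u})" by auto
    then show ?case
    proof cases
      case 1
      then show ?thesis using Cons.IH[of c] Cons.prems by force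
    next
      case 2
      have "k + length h \<notin> b" using b by auto
      then have "card c = Suc (card (b - {u}))" using 2 b by simp
      then have "card c = k" using 2 b card_Suc_Diff1 by metis
      moreover have "c \<subseteq> {0..<k + length (b # h)}" using 2(2) b(1) by auto
      ultimately show ?thesis using 2(2) b(2) by simp
    qed
  qed auto
  then show "c \<subseteq> {0..<k + length h}" "finite c" "card c = k" by auto
qed

lemma finite_active: "valid k h \<Longrightarrow> finite (active k h)"
proof (induction h)
  case (Cons c h)
  then have "finite c" using active_clique(2) by auto
  then show ?case using Cons by simp
qed simp

lemma new_vertex_notin: "valid k h \<Longrightarrow> c \<in> active k h \<Longrightarrow> k + length h \<notin> c"
  using active_clique(1) by fastforce

lemma Max_active:
  assumes "valid k h" "c \<in> active k h" "k > 0"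
  shows "Max c \<in> c" "Max c < k + length h" "k - 1 \<le> Max c"
proof -
  have fin: "finite c" "c \<noteq> {}" using active_clique[OF assms(1,2)] assms(3) by auto
  then show *: "Max c \<in> c" by simp
  then show "Max c < k + length h" using active_clique(1)[OF assms(1,2)] by auto
  have "c \<subseteq> {..Max c}" using fin by auto
  from card_mono[OF _ this] show "k - 1 \<le> Max c" using active_clique(3)[OF assms(1,2)] by simp
qed

text \<open>One clique leaves and \<open>k\<close> enter; the entering ones are distinct from each
  other and, containing the new vertex, from all old ones. The removed clique stands on the left to
  avoid subtraction on \<open>nat\<close>.\<close>

lemma count_active_Cons:
  assumes "valid k h" "c \<in> active k h"
  shows "count_active k (c # h) P + of_bool (P c) =
    count_active k h P + card {u \<in> c. P (insert (k + length h) (c - {u}))}"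
proof -
  let ?z = "k + length h"
  let ?f = "\<lambda>u. insert ?z (c - {u})"
  have z: "?z \<notin> b" if "b \<in> active k h" for b using new_vertex_notin[OF assms(1) that] .
  have inj: "inj_on ?f c"
  proof (rule inj_onI)
    fix u v assume uv: "u \<in> c" "v \<in> c" "?f u = ?f v"
    then have "c - {u} = c - {v}" using z[OF assms(2)] by (metis Diff_iff insert_ident)
    then show "u = v" using uv by blast
  qed
  have "{b \<in> active k (c # h). P b} = ({b \<in> active k h. P b} - {c}) \<union> ?f ` {u \<in> c. P (?f u)}"
    by auto
  moreover have "card (({b \<in> active k h. P b} - {c}) \<union> ?f ` {u \<in> c. P (?f u)})
      = card ({b \<in> active k h. P b} - {c}) + card (?f ` {u \<in> c. P (?f u)})"
    using finite_active[OF assms(1)] active_clique(2)[OF assms] z by (intro card_Un_disjoint) auto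
  moreover have "card (?f ` {u \<in> c. P (?f u)}) = card {u \<in> c. P (?f u)}"
    by (intro card_image inj_on_subset[OF inj]) auto
  moreover have "card ({b \<in> active k h. P b} - {c}) + of_bool (P c) = card {b \<in> active k h. P b}"
  proof (cases "P c")
    case True
    then have "c \<in> {b \<in> active k h. P b}" using assms(2) by simp
    then show ?thesis using True finite_active[OF assms(1)] card_Suc_Diff1[of "{b \<in> active k h. P b}" c] by simp
  qed simp
  ultimately show ?thesis by (simp add: count_active_def)
qed

text \<open>If \<open>w\<close> lies in \<open>c\<close>, then \<open>c\<close> is lost and all new
  cliques but the one omitting \<open>w\<close> are gained, a net change of
  \<open>(k - 1) - 1\<close>.\<close>

lemma count_active_Cons_mem:
  assumes "valid k h" "c \<in> active k h" "w < k + length h" "k \<ge> 3"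
  shows "count_active k (c # h) (\<lambda>b. w \<in> b)
    = count_active k h (\<lambda>b. w \<in> b) + (if w \<in> c then k - 2 else 0)"
proof -
  have "{u \<in> c. w \<in> insert (k + length h) (c - {u})} = (if w \<in> c then c - {w} else {})"
    using assms(3) by auto
  then show ?thesis
    using count_active_Cons[OF assms(1,2), of "\<lambda>b. w \<in> b"] active_clique[OF assms(1,2)] assms(4)
    by (auto split: if_splits)
qed

lemma count_active_Cons_new:
  assumes "valid k h" "c \<in> active k h"
  shows "count_active k (c # h) (\<lambda>b. k + length h \<in> b) = k"
proof -
  have "{b \<in> active k h. k + length h \<in> b} = {}" using new_vertex_notin[OF assms(1)] by auto
  then have "count_active k h (\<lambda>b. k + length h \<in> b) = 0"
    by (metis card.empty count_active_def)
  then show ?thesis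
    using count_active_Cons[OF assms, of "\<lambda>b. k + length h \<in> b"] active_clique[OF assms]
      new_vertex_notin[OF assms] by simp
qed

lemma count_active_True: "count_active k h (\<lambda>_. True) = card (active k h)"
  by (simp add: count_active_def)

lemma card_active:
  assumes "valid k h" "k > 0"
  shows "card (active k h) = 1 + (k - 1) * length h"
  using assms
proof (induction h)
  case (Cons c h)
  then have "card (active k (c # h)) + 1 = card (active k h) + k"
    using count_active_Cons[of k h c "\<lambda>_. True"] active_clique(3)[of k h c]
    by (simp add: count_active_True del: active.simps)
  then show ?case using Cons by (cases k) (auto simp del: active.simps)
qed simp

section \<open>The tree of parents\<close>

lemma parent_bounds:
  "valid k h \<Longrightarrow> k > 0 \<Longrightarrow> y \<in> {k..<k + length h} \<Longrightarrow> parent k h y \<in> {k - 1..<y}"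
proof (induction h)
  case (Cons c h)
  have h: "valid k h" "c \<in> active k h" "k > 0" using Cons.prems by auto
  show ?case
  proof (cases "y = k + length h")
    case True
    then show ?thesis using Max_active(2,3)[OF h] by simp
  next
    case False
    then have "parent k h y \<in> {k - 1..<y}" using Cons.prems by (intro Cons.IH) auto
    then show ?thesis using False by simp
  qed
qed simp

lemma ancestors_subset: "ancestors k h y \<subseteq> {k..<k + length h}"
proof (induction h arbitrary: y)
  case (Cons c h)
  have "ancestors k h x \<subseteq> {k..<k + length (c # h)}" for x
    by (rule order_trans[OF Cons.IH]) simp
  then show ?case by simp
qed simp

lemma ancestors_le: "valid k h \<Longrightarrow> k > 0 \<Longrightarrow> x \<in> ancestors k h y \<Longrightarrow> x \<le> y"
proof (induction h arbitrary: y)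
  case (Cons c h)
  have h: "valid k h" "c \<in> active k h" "k > 0" using Cons.prems by auto
  show ?case
  proof (cases "y = k + length h")
    case True
    then have "x = y \<or> x \<le> Max c" using Cons.IH[OF h(1,3), of "Max c"] Cons.prems(3) by auto
    then show ?thesis using True Max_active(2)[OF h] by linarith
  next
    case False
    then show ?thesis using Cons.IH[OF h(1,3), of y] Cons.prems(3) by simp
  qed
qed simp

text \<open>The recursion fixes the ancestors of \<open>y\<close> when \<open>y\<close> is created;
  the parent is older, so its ancestors no longer change either.\<close>

lemma ancestors_parent:
  "valid k h \<Longrightarrow> k > 0 \<Longrightarrow> y \<in> {k..<k + length h} \<Longrightarrow>
    ancestors k h y = insert y (ancestors k h (parent k h y))"
proof (induction h)
  case (Cons c h)
  have h: "valid k h" "c \<in> active k h" "k > 0" using Cons.prems by auto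
  show ?case
  proof (cases "y = k + length h")
    case True
    then show ?thesis using Max_active(2)[OF h] by simp
  next
    case False
    then have y: "y \<in> {k..<k + length h}" using Cons.prems by auto
    then have "parent k h y < y" using parent_bounds[OF h(1,3) y] by simp
    then show ?thesis using Cons.IH[OF h(1,3) y] False y by simp
  qed
qed simp

lemma parent_notin_ancestors:
  "valid k h \<Longrightarrow> k > 0 \<Longrightarrow> y \<in> {k..<k + length h} \<Longrightarrow> y \<notin> ancestors k h (parent k h y)"
  using ancestors_le[of k h y "parent k h y"] parent_bounds[of k h y] by auto

lemma relay_range:
  "y \<in> {k..<k + length h} \<Longrightarrow> relay k h y \<in> {k..<k + length h}"
  by (induction h) auto

section \<open>Evolution of the mass\<close>

lemma Max_insert_new:
  assumes "valid k h" "c \<in> active k h"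
  shows "Max (insert (k + length h) (c - {u})) = k + length h"
proof (rule Max_eqI)
  show "finite (insert (k + length h) (c - {u}))" using active_clique(2)[OF assms] by simp
qed (use active_clique(1)[OF assms] in auto)

text \<open>All \<open>k\<close> cliques that replace \<open>c\<close> have the new vertex as
  maximum, and its older ancestors are those of \<open>Max c\<close>. So either all of them and
  \<open>c\<close> are below \<open>y\<close>, or none is.\<close>

lemma mass_Cons:
  assumes "valid k h" "c \<in> active k h" "y < k + length h" "k \<ge> 3"
  shows "mass k (c # h) y = mass k h y + (if y \<in> ancestors k h (Max c) then k - 1 else 0)"
proof -
  let ?P = "\<lambda>b. y \<in> ancestors k (c # h) (Max b)"
  have eq: "?P b \<longleftrightarrow> y \<in> ancestors k h (Max b)" if "b \<in> active k h" for b
    using Max_active(2)[OF assms(1) that] assms by auto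
  have "?P (insert (k + length h) (c - {u})) \<longleftrightarrow> y \<in> ancestors k h (Max c)" for u
    using assms(3) by (simp add: Max_insert_new[OF assms(1,2)])
  then have "mass k (c # h) y + of_bool (y \<in> ancestors k h (Max c))
    = count_active k h ?P + card {u \<in> c. y \<in> ancestors k h (Max c)}"
    using count_active_Cons[OF assms(1,2), of ?P] eq[OF assms(2)] by (simp add: mass_def)
  moreover have "count_active k h ?P = mass k h y"
    unfolding mass_def count_active_def using eq
    by (intro arg_cong[where f=card] Collect_cong conj_cong refl)
  ultimately show ?thesis using active_clique(3)[OF assms(1,2)] assms(4) by auto
qed

lemma mass_new:
  assumes "valid k h" "c \<in> active k h" "k \<ge> 3"
  shows "mass k (c # h) (k + length h) = k"
proof -
  let ?z = "k + length h"
  let ?P = "\<lambda>b. ?z \<in> ancestors k (c # h) (Max b)"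
  have no: "\<not> ?P b" if "b \<in> active k h" for b
    using Max_active(2)[OF assms(1) that] ancestors_subset[of k h "Max b"] assms by auto
  have "?P (insert ?z (c - {u}))" for u by (simp add: Max_insert_new[OF assms(1,2)])
  moreover have "count_active k h ?P = 0"
    unfolding count_active_def using no by (metis (mono_tags, lifting) card.empty empty_Collect_eq)
  ultimately show ?thesis
    using count_active_Cons[OF assms(1,2), of ?P] no[OF assms(2)] active_clique(3)[OF assms(1,2)]
    by (simp add: mass_def)
qed

text \<open>A new descendant of \<open>y\<close> raises the left side by 1 and the mass by
  \<open>k - 1\<close>; when \<open>y\<close> itself is created, the sides are 1 and
  \<open>k\<close>.\<close>

lemma descendants_le_mass:
  assumes "valid k h" "k \<ge> 3"
  shows "card {v \<in> {k..<k + length h}. y \<in> ancestors k h v} \<le> mass k h y"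
  using assms(1)
proof (induction h)
  case (Cons c h)
  let ?z = "k + length h"
  have h: "valid k h" "c \<in> active k h" using Cons.prems by auto
  have split: "{v \<in> {k..<k + length (c # h)}. y \<in> ancestors k (c # h) v}
    = {v \<in> {k..<?z}. y \<in> ancestors k h v} \<union> (if y \<in> ancestors k (c # h) ?z then {?z} else {})"
    by auto
  consider "y < ?z" | "y = ?z" | "y > ?z" by linarith
  then show ?case
  proof cases
    case 1
    then have "card {v \<in> {k..<k + length (c # h)}. y \<in> ancestors k (c # h) v}
      \<le> card {v \<in> {k..<?z}. y \<in> ancestors k h v} + (if y \<in> ancestors k h (Max c) then 1 else 0)"
      unfolding split using card_Un_le[of "{v \<in> {k..<?z}. y \<in> ancestors k h v}" "{?z}"] by auto
    then show ?thesis using mass_Cons[OF h 1 assms(2)] Cons.IH[OF h(1)] assms(2)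
      by (auto split: if_splits simp del: ancestors.simps)
  next
    case 2
    have "y \<notin> ancestors k h v" for v using 2 ancestors_subset[of k h v] by auto
    then have e: "{v \<in> {k..<?z}. y \<in> ancestors k h v} = {}" by blast
    have "card {v \<in> {k..<k + length (c # h)}. y \<in> ancestors k (c # h) v} \<le> 1"
      unfolding split e by simp
    then show ?thesis using mass_new[OF h assms(2)] 2 assms(2) by simp
  next
    case 3
    then have "y \<notin> ancestors k (c # h) v" for v using ancestors_subset[of k "c # h" v] by auto
    then have "{v \<in> {k..<k + length (c # h)}. y \<in> ancestors k (c # h) v} = {}" by blast
    then show ?thesis by (metis card.empty le0)
  qed
qed simp

section \<open>Evolution of the relay and its weight\<close>

lemma weight_new:
  assumes "valid k h" "c \<in> active k h" "y = k + length h \<or> {y, parent k h y} \<subseteq> c"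
  shows "weight k (c # h) y = k"
  using count_active_Cons_new[OF assms(1,2)] assms(3) by (auto simp: weight_def)

lemma weight_old:
  assumes "valid k h" "c \<in> active k h" "y \<in> {k..<k + length h}" "k \<ge> 3" "\<not> {y, parent k h y} \<subseteq> c"
  shows "weight k (c # h) y = weight k h y + (if relay k h y \<in> c then k - 2 else 0)"
proof -
  have "relay k (c # h) y = relay k h y" using assms(3,5) by auto
  then show ?thesis
    using count_active_Cons_mem[OF assms(1,2) _ assms(4), of "relay k h y"] relay_range[OF assms(3)]
    by (auto simp: weight_def simp del: relay.simps)
qed

text \<open>Each relay starts with weight \<open>k\<close>, and its weight does not drop until the
  next relay takes over. This makes \<open>D y - k\<close> nonnegative in the drift
  estimate.\<close>

lemma weight_ge:
  assumes "valid k h" "y \<in> {k..<k + length h}" "k \<ge> 3"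
  shows "k \<le> weight k h y"
  using assms(1,2)
proof (induction h)
  case (Cons c h)
  have h: "valid k h" "c \<in> active k h" using Cons.prems by auto
  show ?case
  proof (cases "y = k + length h \<or> {y, parent k h y} \<subseteq> c")
    case True
    then show ?thesis using weight_new[OF h] by simp
  next
    case False
    then have y: "y \<in> {k..<k + length h}" using Cons.prems by auto
    then show ?thesis using weight_old[OF h y assms(3)] Cons.IH[OF h(1) y] False by simp
  qed
qed simp

text \<open>At the birth of \<open>y\<close> only the new clique omitting \<open>Max c\<close>
  misses the parent. Later, a chosen clique containing both endpoints is replaced by
  \<open>k - 2 \<ge> 1\<close> new ones containing both. The lemma bounds from below how often the
  relay is renewed.\<close>

lemma edge_active_ge:
  assumes "valid k h" "y \<in> {k..<k + length h}" "k \<ge> 3"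
  shows "k - 1 \<le> count_active k h (\<lambda>c. {y, parent k h y} \<subseteq> c)"
  using assms(1,2)
proof (induction h)
  case (Cons c h)
  let ?z = "k + length h"
  let ?P = "\<lambda>b. {y, parent k (c # h) y} \<subseteq> b"
  have h: "valid k h" "c \<in> active k h" using Cons.prems by auto
  have c: "finite c" "card c = k" using active_clique[OF h] by auto
  show ?case
  proof (cases "y = ?z")
    case True
    have M: "Max c \<in> c" "Max c \<noteq> ?z" using Max_active[OF h] assms(3) by auto
    have "{u \<in> c. ?P (insert ?z (c - {u}))} = c - {Max c}" using True M by auto
    moreover have nc: "\<not> ?P c" using True new_vertex_notin[OF h] by simp
    moreover have "card (c - {Max c}) = k - 1" using c M by simp
    ultimately show ?thesis
      using count_active_Cons[OF h, of ?P] by (simp only: of_bool_def if_False)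
  next
    case False
    then have y: "y \<in> {k..<?z}" using Cons.prems by auto
    then have q: "parent k h y < y" "parent k (c # h) y = parent k h y"
      using parent_bounds[OF h(1) _ y] assms(3) by auto
    have IH: "k - 1 \<le> count_active k h ?P" using Cons.IH[OF h(1) y] q(2) by simp
    have "{u \<in> c. ?P (insert ?z (c - {u}))} = (if ?P c then c - {y, parent k h y} else {})"
      using y q by auto
    moreover have "card (c - {y, parent k h y}) = k - 2" if "?P c"
      using c q that by (subst card_Diff_subset) auto
    ultimately show ?thesis
      using count_active_Cons[OF h, of ?P] IH assms(3) by (auto split: if_splits simp del: parent.simps)
  qed
qed simp


section \<open>Drift of the potential\<close>

lemma sum_active_indicator:
  assumes "valid k h"
  shows "(\<Sum>c\<in>active k h. of_bool (P c)) = real (count_active k h P)"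
  using finite_active[OF assms] by (simp add: count_active_def Int_def)

text \<open>Summed over all choices of \<open>c\<close>, the event that the mass of \<open>y\<close>
  grows occurs \<open>mass k h y\<close> times, so the increments reproduce the mass itself with
  factor \<open>k - 1\<close>. The new vertex adds \<open>k\<close> for every choice.\<close>

lemma total_mass_drift:
  assumes "valid k h" "k \<ge> 3"
  shows "(\<Sum>c\<in>active k h. total_mass k (c # h)) =
    (real (card (active k h)) + real (k - 1)) * total_mass k h + real k * real (card (active k h))"
proof -
  let ?Y = "{k..<k + length h}"
  let ?A = "\<lambda>c y. of_bool (y \<in> ancestors k h (Max c)) :: real"
  have step: "total_mass k (c # h) = (\<Sum>y\<in>?Y. mass k h y + real (k - 1) * ?A c y) + real k"
    if "c \<in> active k h" for c
  proof -
    have "real (mass k (c # h) y) = mass k h y + real (k - 1) * ?A c y" if "y \<in> ?Y" for y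
      using that mass_Cons[OF assms(1) \<open>c \<in> active k h\<close>, of y] assms(2) by simp
    then show ?thesis using mass_new[OF assms(1) that assms(2)] by (simp add: total_mass_def)
  qed
  have "(\<Sum>c\<in>active k h. total_mass k (c # h))
    = (\<Sum>y\<in>?Y. \<Sum>c\<in>active k h. mass k h y + real (k - 1) * ?A c y) + real k * card (active k h)"
    by (subst sum.swap) (simp add: step sum.distrib)
  also have "(\<Sum>y\<in>?Y. \<Sum>c\<in>active k h. mass k h y + real (k - 1) * ?A c y)
    = (\<Sum>y\<in>?Y. (real (card (active k h)) + real (k - 1)) * mass k h y)"
    by (intro sum.cong refl) (simp only: sum.distrib sum_distrib_left[symmetric]
        sum_active_indicator[OF assms(1)] mass_def[symmetric], simp add: algebra_simps)
  finally show ?thesis by (simp add: total_mass_def sum_distrib_left)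
qed

text \<open>The product for each \<open>y\<close> is bounded by an expression linear in three
  indicators of \<open>c\<close>: \<open>c\<close> lies below \<open>y\<close>, contains the relay,
  or renews it. Summing over \<open>c\<close> turns these into \<open>M y\<close>,
  \<open>D y\<close> and a number that is at least \<open>k - 1\<close>.\<close>

lemma potential_drift:
  assumes "valid k h" "k \<ge> 3"
  shows "(\<Sum>c\<in>active k h. potential k (c # h)) \<le>
    (real (card (active k h)) + real (k - 2)) * potential k h
      + 2 * real (k - 1)^2 * total_mass k h + real k ^ 2 * real (card (active k h))"
proof -
  let ?Y = "{k..<k + length h}"
  let ?a = "real (card (active k h))"
  let ?A = "\<lambda>c y. of_bool (y \<in> ancestors k h (Max c)) :: real"
  let ?B = "\<lambda>c y. of_bool (relay k h y \<in> c) :: real"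
  let ?R = "\<lambda>c y. of_bool ({y, parent k h y} \<subseteq> c) :: real"
  let ?M = "\<lambda>y. real (mass k h y)"
  let ?D = "\<lambda>y. real (weight k h y)"
  \<comment> \<open>The expansion of \<open>(M + (k - 1) * A) * (D + (k - 2) * B)\<close>, with
    \<open>A * B\<close> replaced by \<open>A\<close> to stay linear, and with the gain from a reset
    subtracted.\<close>
  let ?u = "\<lambda>c y. ?M y * ?D y + (real (k - 1) * ?D y + real (k - 1) * real (k - 2)) * ?A c y
      + ?M y * real (k - 2) * ?B c y - ?M y * (?D y - k) * ?R c y"
  have step: "potential k (c # h) \<le> (\<Sum>y\<in>?Y. ?u c y) + real k ^ 2"
    if c: "c \<in> active k h" for c
  proof -
    have "real (mass k (c # h) y) * real (weight k (c # h) y) \<le> ?u c y" if y: "y \<in> ?Y" for y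
    proof -
      have m: "real (mass k (c # h) y) = ?M y + real (k - 1) * ?A c y"
        using y mass_Cons[OF assms(1) c, of y] assms(2) by simp
      have D: "real k \<le> ?D y" using weight_ge[OF assms(1) y assms(2)] by simp
      \<comment> \<open>A reset of the relay contributes \<open>- M y * (D y - k)\<close>, which outweighs the growth of its degree.\<close>
      show ?thesis
      proof (cases "{y, parent k h y} \<subseteq> c")
        case True
        then have w: "weight k (c # h) y = k" using weight_new[OF assms(1) c] by simp
        have "?A c y * real (k - 1) * k \<le> ?A c y * real (k - 1) * ?D y" using D by (intro mult_left_mono) auto
        moreover have "0 \<le> ?A c y * real (k - 1) * real (k - 2) + ?M y * real (k - 2) * ?B c y" by simp
        moreover have "?R c y = 1" using True by simp
        ultimately show ?thesis unfolding m w by (simp only: algebra_simps mult_1_right)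
      next
        case False
        then have w: "real (weight k (c # h) y) = ?D y + real (k - 2) * ?B c y"
          using weight_old[OF assms(1) c y assms(2)] by simp
        have "?A c y * ?B c y \<le> ?A c y" by simp
        then have "real (k - 1) * real (k - 2) * (?A c y * ?B c y) \<le> real (k - 1) * real (k - 2) * ?A c y"
          by (intro mult_left_mono) auto
        moreover have "?R c y = 0" using False by simp
        ultimately show ?thesis unfolding m w by (simp only: algebra_simps mult_zero_right)
      qed
    qed
    then have "(\<Sum>y\<in>?Y. real (mass k (c # h) y) * real (weight k (c # h) y)) \<le> (\<Sum>y\<in>?Y. ?u c y)"
      by (rule sum_mono)
    then show ?thesis
      using mass_new[OF assms(1) c assms(2)] weight_new[OF assms(1) c, of "k + length h"]
      by (simp add: potential_def power2_eq_square)
  qed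
  have col: "(\<Sum>c\<in>active k h. ?u c y) \<le>
    (?a + real (k - 2)) * (?M y * ?D y) + 2 * real (k - 1)^2 * ?M y" if y: "y \<in> ?Y" for y
  proof -
    let ?N = "real (count_active k h (\<lambda>c. {y, parent k h y} \<subseteq> c))"
    have D: "real k \<le> ?D y" using weight_ge[OF assms(1) y assms(2)] by simp
    have N: "real (k - 1) \<le> ?N" using edge_active_ge[OF assms(1) y assms(2)] by simp
    have "(\<Sum>c\<in>active k h. ?u c y) = ?a * (?M y * ?D y)
        + (real (k - 1) * ?D y + real (k - 1) * real (k - 2)) * ?M y
        + ?M y * real (k - 2) * ?D y - ?M y * (?D y - k) * ?N"
      by (simp only: sum.distrib sum_subtractf sum_distrib_left[symmetric] sum_constant
        sum_active_indicator[OF assms(1)] mass_def[symmetric] weight_def[symmetric] mult.left_commute[of "real (card (active k h))"])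
    also have "\<dots> \<le> ?a * (?M y * ?D y)
        + (real (k - 1) * ?D y + real (k - 1) * real (k - 2)) * ?M y
        + ?M y * real (k - 2) * ?D y - ?M y * (?D y - k) * real (k - 1)"
      using D N by (intro diff_mono order_refl mult_left_mono) auto
    \<comment> \<open>The coefficient of \<open>M * D\<close> is
      \<open>a + (k - 1) + (k - 2) - (k - 1)\<close>; that of \<open>M\<close> is
      \<open>(k - 1) * (k - 2) + k * (k - 1)\<close>. Resets thus cancel the growth of the
      mass.\<close>
    also have "\<dots> = (?a + real (k - 2)) * (?M y * ?D y) + 2 * real (k - 1)^2 * ?M y"
      using assms(2) by (simp add: of_nat_diff algebra_simps power2_eq_square)
    finally show ?thesis .
  qed
  have "(\<Sum>c\<in>active k h. potential k (c # h)) \<le> (\<Sum>c\<in>active k h. (\<Sum>y\<in>?Y. ?u c y) + real k ^ 2)"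
    by (intro sum_mono step)
  also have "\<dots> = (\<Sum>y\<in>?Y. \<Sum>c\<in>active k h. ?u c y) + real k ^ 2 * ?a"
    unfolding sum.distrib by (subst sum.swap) simp
  also have "\<dots> \<le> (\<Sum>y\<in>?Y. (?a + real (k - 2)) * (?M y * ?D y) + 2 * real (k - 1)^2 * ?M y) + real k ^ 2 * ?a"
    by (intro add_right_mono sum_mono col)
  also have "\<dots> = (?a + real (k - 2)) * potential k h
      + 2 * real (k - 1)^2 * total_mass k h + real k ^ 2 * ?a"
    by (simp only: sum.distrib sum_distrib_left[symmetric] potential_def total_mass_def)
  finally show ?thesis .
qed

section \<open>Routes to the root\<close>

lemma nbrs_sym: "w \<in> nbrs E x \<longleftrightarrow> x \<in> nbrs E w"
  by (auto simp: nbrs_def insert_commute)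

lemma edges_range: "valid k h \<Longrightarrow> {u, w} \<in> edges k h \<Longrightarrow> u < k + length h"
proof (induction h)
  case Nil
  then show ?case by (auto simp: doubleton_eq_iff)
next
  case (Cons c h)
  then have c: "c \<subseteq> {0..<k + length h}" using active_clique(1) by simp
  from Cons.prems consider "{u, w} \<in> edges k h" | x where "x \<in> c" "{u, w} = {k + length h, x}"
    by auto
  then show ?case
  proof cases
    case 1
    then show ?thesis using Cons by simp
  next
    case 2
    then show ?thesis using c by (auto simp: doubleton_eq_iff)
  qed
qed

lemma nbrs_range: "valid k h \<Longrightarrow> w \<in> nbrs (edges k h) x \<Longrightarrow> w < k + length h"
  unfolding nbrs_def using edges_range[of k h w x] by (simp add: insert_commute)

lemma finite_nbrs: "valid k h \<Longrightarrow> finite (nbrs (edges k h) x)"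
  by (rule finite_subset[of _ "{..<k + length h}"]) (blast dest: nbrs_range, simp)

lemma nbrs_Cons:
  assumes "valid k h" "c \<in> active k h"
  shows "nbrs (edges k (c # h)) w = nbrs (edges k h) w \<union>
    (if w = k + length h then c else if w \<in> c then {k + length h} else {})"
  using new_vertex_notin[OF assms] by (auto simp: nbrs_def doubleton_eq_iff)

lemma nbrs_new_empty: "valid k h \<Longrightarrow> nbrs (edges k h) (k + length h) = {}"
  using edges_range[of k h "k + length h"] by (auto simp: nbrs_def)

text \<open>Both sides equal \<open>k\<close> at the birth of \<open>w\<close>, and each further
  neighbour brings \<open>k - 2 \<ge> 1\<close> additional active cliques. Initial vertices are
  excluded: they start with \<open>k - 1\<close> neighbours but a single active clique.\<close>

lemma degree_le_count_active:
  assumes "valid k h" "k \<ge> 3" "w \<in> {k..<k + length h}"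
  shows "card (nbrs (edges k h) w) \<le> count_active k h (\<lambda>c. w \<in> c)"
  using assms(1,3)
proof (induction h)
  case (Cons c h)
  then have h: "valid k h" "c \<in> active k h" by auto
  show ?case
  proof (cases "w = k + length h")
    case True
    then show ?thesis
      using count_active_Cons_new[OF h] nbrs_new_empty[OF h(1)] active_clique(3)[OF h]
      by (simp add: nbrs_Cons[OF h] del: edges.simps)
  next
    case False
    then have w: "w < k + length h" "w \<in> {k..<k + length h}" using Cons.prems by auto
    have "card (nbrs (edges k (c # h)) w) \<le> card (nbrs (edges k h) w) + (if w \<in> c then 1 else 0)"
      unfolding nbrs_Cons[OF h] using False card_Un_le[of _ "{k + length h}"] by auto
    then show ?thesis
      using count_active_Cons_mem[OF h w(1) assms(2)] Cons.IH[OF h(1) w(2)] assms(2)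
      by (auto split: if_splits simp del: edges.simps)
  qed
qed simp

lemma relay_nbrs:
  assumes "valid k h" "k \<ge> 3" "y \<in> {k..<k + length h}"
  shows "parent k h y \<in> nbrs (edges k h) y"
    and "relay k h y = y \<or> relay k h y \<in> nbrs (edges k h) y \<and> parent k h y \<in> nbrs (edges k h) (relay k h y)"
proof -
  have "parent k h y \<in> nbrs (edges k h) y \<and> (relay k h y = y \<or>
    relay k h y \<in> nbrs (edges k h) y \<and> parent k h y \<in> nbrs (edges k h) (relay k h y))"
    using assms(1,3)
  proof (induction h)
    case (Cons c h)
    then have h: "valid k h" "c \<in> active k h" by auto
    let ?z = "k + length h"
    show ?case
    proof (cases "y = ?z")
      case True
      then show ?thesis using Max_active(1)[OF h] assms(2) by (simp add: nbrs_Cons[OF h] del: edges.simps)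
    next
      case False
      then have y: "y \<in> {k..<?z}" using Cons.prems by auto
      have "parent k h y \<noteq> ?z" using parent_bounds[OF h(1) _ y] y assms(2) by auto
      moreover have "relay k h y \<noteq> ?z" using relay_range[OF y] by auto
      ultimately show ?thesis
        using Cons.IH[OF h(1) y] False by (auto simp: nbrs_Cons[OF h] simp del: edges.simps)
    qed
  qed simp
  then show "parent k h y \<in> nbrs (edges k h) y"
    and "relay k h y = y \<or> relay k h y \<in> nbrs (edges k h) y \<and> parent k h y \<in> nbrs (edges k h) (relay k h y)"
    by auto
qed

text \<open>Across an edge, the rumour passes with probability at least the reciprocal of the smaller degree
  in each round: either endpoint may contact the other.\<close>

inductive route :: "nat set set \<Rightarrow> nat \<Rightarrow> nat \<Rightarrow> nat \<Rightarrow> bool" for E where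
  start: "route E u u 0"
| hop: "w \<in> nbrs E x \<Longrightarrow> route E w u c \<Longrightarrow>
    route E x u (min (card (nbrs E x)) (card (nbrs E w)) + c)"

lemma route_trans: "route E x y c \<Longrightarrow> route E y u d \<Longrightarrow> route E x u (c + d)"
  by (induction rule: route.induct) (auto simp: add.assoc intro: route.hop)

lemma route_edge: "w \<in> nbrs E x \<Longrightarrow> route E x w (min (card (nbrs E x)) (card (nbrs E w)))"
  using route.hop[OF _ route.start] by fastforce

lemma route_sym: "route E x u c \<Longrightarrow> route E u x c"
proof (induction rule: route.induct)
  case (hop w x u c)
  then have "route E w x (min (card (nbrs E w)) (card (nbrs E x)))"
    by (intro route_edge) (simp add: nbrs_sym)
  from route_trans[OF hop.IH this] show ?case by (simp add: add.commute min.commute)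
qed (rule route.start)

text \<open>Each of the at most two edges through the relay has the relay as an endpoint, so the
  smaller degree is at most the relay's degree.\<close>

lemma route_parent:
  assumes "valid k h" "k \<ge> 3" "y \<in> {k..<k + length h}"
  shows "\<exists>c \<le> 2 * weight k h y. route (edges k h) y (parent k h y) c"
proof -
  let ?E = "edges k h" and ?w = "relay k h y"
  have D: "card (nbrs ?E ?w) \<le> weight k h y"
    using degree_le_count_active[OF assms(1,2) relay_range[OF assms(3)]] by (simp add: weight_def)
  from relay_nbrs(2)[OF assms] show ?thesis
  proof
    assume "?w = y"
    then have "min (card (nbrs ?E y)) (card (nbrs ?E (parent k h y))) \<le> 2 * weight k h y"
      using D by simp
    then show ?thesis using route_edge[OF relay_nbrs(1)[OF assms]] by blast
  next
    assume *: "?w \<in> nbrs ?E y \<and> parent k h y \<in> nbrs ?E ?w"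
    let ?deg = "\<lambda>x. card (nbrs ?E x)"
    have "route ?E y (parent k h y) (min (?deg y) (?deg ?w) + min (?deg ?w) (?deg (parent k h y)))"
      using * by (intro route_trans[OF route_edge route_edge]) auto
    moreover have "min (?deg y) (?deg ?w) + min (?deg ?w) (?deg (parent k h y)) \<le> 2 * weight k h y"
      using D by linarith
    ultimately show ?thesis by blast
  qed
qed

text \<open>Bounds the cost of the tree path from \<open>v\<close> to the root: its edges correspond
  to the ancestors, each leading to its parent.\<close>

definition climb :: "nat \<Rightarrow> nat set list \<Rightarrow> nat \<Rightarrow> nat" where
  "climb k h v = (\<Sum>y\<in>ancestors k h v. 2 * weight k h y)"

lemma finite_ancestors: "finite (ancestors k h v)"
  by (rule finite_subset[OF ancestors_subset]) simp

lemma route_root: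
  assumes "valid k h" "k \<ge> 3" "v \<in> {k - 1..<k + length h}"
  shows "\<exists>c \<le> climb k h v. route (edges k h) v (k - 1) c"
  using assms(3)
proof (induction v rule: less_induct)
  case (less v)
  show ?case
  proof (cases "v = k - 1")
    case True
    then show ?thesis using route.start by blast
  next
    case False
    then have v: "v \<in> {k..<k + length h}" using less.prems by auto
    let ?p = "parent k h v"
    have p: "?p < v" "?p \<in> {k - 1..<k + length h}"
      using parent_bounds[OF assms(1) _ v] assms(2) v by auto
    obtain c where c: "c \<le> climb k h ?p" "route (edges k h) ?p (k - 1) c" using less.IH[OF p] by blast
    obtain d where d: "d \<le> 2 * weight k h v" "route (edges k h) v ?p d"
      using route_parent[OF assms(1,2) v] by blast
    have "climb k h v = 2 * weight k h v + climb k h ?p"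
      using ancestors_parent[OF assms(1) _ v] parent_notin_ancestors[OF assms(1) _ v] assms(2)
      by (simp add: climb_def finite_ancestors)
    then show ?thesis using route_trans[OF d(2) c(2)] c(1) d(1) by (intro exI[of _ "d + c"]) auto
  qed
qed

text \<open>Exchanging the sums charges \<open>2 * weight k h y\<close> once per descendant of
  \<open>y\<close>, and the mass bounds the number of descendants.\<close>

lemma sum_climb_le:
  assumes "valid k h" "k \<ge> 3"
  shows "(\<Sum>v = k - 1..<k + length h. real (climb k h v)) \<le> 2 * potential k h"
proof -
  let ?Y = "{k..<k + length h}"
  have "{k - 1..<k + length h} = insert (k - 1) ?Y" using assms(2) by auto
  moreover have "ancestors k h (k - 1) = {}"
    using ancestors_le[OF assms(1), of _ "k - 1"] ancestors_subset[of k h "k - 1"] assms(2) by fastforce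
  ultimately have "(\<Sum>v = k - 1..<k + length h. climb k h v) = (\<Sum>v\<in>?Y. climb k h v)"
    using assms(2) by (simp add: climb_def)
  also have "\<dots> = (\<Sum>v\<in>?Y. \<Sum>y\<in>?Y. if y \<in> ancestors k h v then 2 * weight k h y else 0)"
    unfolding climb_def using ancestors_subset by (intro sum.cong refl sum.mono_neutral_cong_left) auto
  also have "\<dots> = (\<Sum>y\<in>?Y. card {v \<in> ?Y. y \<in> ancestors k h v} * (2 * weight k h y))"
    by (subst sum.swap) (simp add: sum.If_cases Int_def)
  also have "\<dots> \<le> (\<Sum>y\<in>?Y. mass k h y * (2 * weight k h y))"
    by (intro sum_mono mult_right_mono descendants_le_mass assms) simp
  finally have "real (\<Sum>v = k - 1..<k + length h. climb k h v) \<le> real (\<Sum>y\<in>?Y. mass k h y * (2 * weight k h y))"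
    by (rule of_nat_mono)
  then show ?thesis by (simp add: potential_def sum_distrib_left mult_ac)
qed

section \<open>Push-Pull along a route\<close>

text \<open>The cost of a cheapest route from the informed set; meaningful only if some route
  exists.\<close>

definition route_dist :: "nat set set \<Rightarrow> nat set \<Rightarrow> nat \<Rightarrow> nat" where
  "route_dist E I u = (LEAST c. \<exists>x\<in>I. route E x u c)"

lemma route_dist_le: "x \<in> I \<Longrightarrow> route E x u c \<Longrightarrow> route_dist E I u \<le> c"
  unfolding route_dist_def by (rule Least_le) blast

lemma route_dist_route:
  assumes "x \<in> I" "route E x u c"
  obtains y where "y \<in> I" "route E y u (route_dist E I u)"
  using LeastI_ex[of "\<lambda>c. \<exists>x\<in>I. route E x u c"] assms unfolding route_dist_def by blast

lemma push_pull_round_superset: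
  "J \<in> set_pmf (push_pull_round V E I) \<Longrightarrow> I \<subseteq> J"
  by (auto simp: push_pull_round_def)

lemma prob_contact:
  assumes "finite V" "x \<in> V" "finite (nbrs E x)" "w \<in> nbrs E x"
  shows "emeasure (Pi_pmf V d (\<lambda>v. pmf_of_set (nbrs E v))) {N. N x = w} = 1 / of_nat (card (nbrs E x))"
proof -
  let ?P = "Pi_pmf V d (\<lambda>v. pmf_of_set (nbrs E v))"
  have "emeasure ?P {N. N x = w} = emeasure (map_pmf (\<lambda>N. N x) ?P) {w}"
    by (simp add: vimage_def)
  also have "map_pmf (\<lambda>N. N x) ?P = pmf_of_set (nbrs E x)"
    using assms by (simp add: Pi_pmf_component)
  also have "emeasure (pmf_of_set (nbrs E x)) {w} = 1 / of_nat (card (nbrs E x))"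
  proof -
    have "card (nbrs E x) > 0" using assms(3,4) by (auto simp: card_gt_0_iff)
    then show ?thesis using assms(3,4)
      divide_ennreal[of 1 "real (card (nbrs E x))"]
      by (subst emeasure_pmf_of_set) (auto simp: ennreal_of_nat_eq_real_of_nat)
  qed
  finally show ?thesis .
qed

text \<open>A push from \<open>x\<close> to \<open>w\<close> and a pull by \<open>w\<close> from
  \<open>x\<close> each suffice, and each has the reciprocal of one degree as probability. The
  smaller degree gives the better bound.\<close>

lemma prob_informed_nbr:
  assumes "finite V" "\<And>x w. w \<in> nbrs E x \<Longrightarrow> w \<in> V" "\<And>x. finite (nbrs E x)"
    and "x \<in> I" "w \<in> nbrs E x"
  shows "1 \<le> of_nat (min (card (nbrs E x)) (card (nbrs E w))) * emeasure (push_pull_round V E I) {J. w \<in> J}"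
proof -
  let ?P = "Pi_pmf V 0 (\<lambda>v. pmf_of_set (nbrs E v))"
  let ?p = "emeasure (push_pull_round V E I) {J. w \<in> J}"
  have xw: "x \<in> nbrs E w" "x \<in> V" "w \<in> V" using assms nbrs_sym by blast+
  have p: "?p = emeasure ?P {N. w \<in> I \<union> N ` I \<union> {u \<in> V. N u \<in> I}}"
    by (simp add: push_pull_round_def vimage_def)
  have "emeasure ?P {N. N x = w} \<le> ?p"
    unfolding p using assms(4) by (intro emeasure_mono) auto
  then have 1: "1 / of_nat (card (nbrs E x)) \<le> ?p"
    using prob_contact[OF assms(1) xw(2) assms(3,5)] by simp
  have "emeasure ?P {N. N w = x} \<le> ?p"
    unfolding p using assms(4) xw by (intro emeasure_mono) auto
  then have 2: "1 / of_nat (card (nbrs E w)) \<le> ?p"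
    using prob_contact[OF assms(1) xw(3) assms(3) xw(1)] by simp
  have *: "1 \<le> of_nat (card (nbrs E y)) * ?p" if "1 / of_nat (card (nbrs E y)) \<le> ?p" "v \<in> nbrs E y" for y v
  proof -
    have "card (nbrs E y) \<noteq> 0" using that(2) assms(3) by auto
    then have "1 = of_nat (card (nbrs E y)) * (1 / of_nat (card (nbrs E y)) :: ennreal)"
      by (simp add: ennreal_times_divide of_nat_less_top)
    also have "\<dots> \<le> of_nat (card (nbrs E y)) * ?p" using that(1) by (intro mult_left_mono) auto
    finally show ?thesis .
  qed
  show ?thesis using *[OF 1 assms(5)] *[OF 2 xw(1)] by (auto simp: min_def)
qed

text \<open>Let \<open>m\<close> be the cost of the first edge of a cheapest route. Its far end is
  informed with probability at least \<open>1 / m\<close>, and the distance then falls by at least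
  \<open>m\<close>; so the expected decrease is at least 1 while \<open>u\<close> is
  uninformed.\<close>

lemma route_dist_drift:
  assumes "finite V" "\<And>x w. w \<in> nbrs E x \<Longrightarrow> w \<in> V" "\<And>x. finite (nbrs E x)"
    and "v \<in> I" "route E v u c"
  shows "(\<integral>\<^sup>+J. of_nat (route_dist E J u) \<partial>push_pull_round V E I) + indicator {I. u \<notin> I} I
    \<le> (of_nat (route_dist E I u) :: ennreal)"
proof (cases "u \<in> I")
  case True
  have "(\<integral>\<^sup>+J. of_nat (route_dist E J u) \<partial>push_pull_round V E I) \<le> (\<integral>\<^sup>+J. 0 \<partial>push_pull_round V E I)"
  proof (rule nn_integral_mono_AE, subst AE_measure_pmf_iff, rule ballI)
    fix J assume "J \<in> set_pmf (push_pull_round V E I)"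
    then have "route_dist E J u \<le> 0"
      using True push_pull_round_superset by (intro route_dist_le[OF _ route.start]) blast
    then show "of_nat (route_dist E J u) \<le> (0::ennreal)" by simp
  qed
  then show ?thesis using True by simp
next
  case False
  let ?d = "route_dist E I u" and ?P = "push_pull_round V E I"
  obtain x where x: "x \<in> I" "route E x u ?d" using route_dist_route[OF assms(4,5)] .
  from x(2) show ?thesis
  proof cases
    case start
    then show ?thesis using x False by simp
  next
    case (hop w c)
    let ?m = "min (card (nbrs E x)) (card (nbrs E w))"
    have "(\<integral>\<^sup>+J. of_nat (route_dist E J u) \<partial>?P) + 1
      \<le> (\<integral>\<^sup>+J. of_nat (route_dist E J u) \<partial>?P) + of_nat ?m * emeasure ?P {J. w \<in> J}"
      by (intro add_left_mono prob_informed_nbr[OF assms(1-3) x(1) hop(2)])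
    also have "\<dots> = (\<integral>\<^sup>+J. of_nat (route_dist E J u) + of_nat ?m * indicator {J. w \<in> J} J \<partial>?P)"
      by (simp add: nn_integral_add nn_integral_cmult)
    also have "\<dots> \<le> (\<integral>\<^sup>+J. of_nat ?d \<partial>?P)"
    proof (rule nn_integral_mono_AE, subst AE_measure_pmf_iff, rule ballI)
      fix J assume "J \<in> set_pmf ?P"
      then have J: "I \<subseteq> J" by (rule push_pull_round_superset)
      \<comment> \<open>If \<open>w\<close> is informed, the rest of the route serves; otherwise the
        old route does, since no vertex forgets the rumor.\<close>
      have "route_dist E J u + ?m * of_bool (w \<in> J) \<le> ?d"
      proof (cases "w \<in> J")
        case True
        then show ?thesis using route_dist_le[OF True hop(3)] hop(1) by simp
      next
        case False
        then show ?thesis using route_dist_le[OF _ x(2), of J] x(1) J by auto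
      qed
      then have "(of_nat (route_dist E J u + ?m * of_bool (w \<in> J)) :: ennreal) \<le> of_nat ?d"
        by (rule of_nat_mono)
      then show "of_nat (route_dist E J u) + of_nat ?m * indicator {J. w \<in> J} J \<le> (of_nat ?d :: ennreal)"
        by (simp add: indicator_def of_bool_def split: if_splits)
    qed
    also have "\<dots> = of_nat ?d" by simp
    finally show ?thesis using False by simp
  qed
qed

lemma push_pull_Suc: "push_pull V E (Suc t) I = bind_pmf (push_pull V E t I) (push_pull_round V E)"
  by (simp add: push_pull_def)

lemma push_pull_superset: "J \<in> set_pmf (push_pull V E t I) \<Longrightarrow> I \<subseteq> J"
proof (induction t arbitrary: J)
  case 0
  then show ?case by (simp add: push_pull_def)
next
  case (Suc t)
  then show ?case using push_pull_round_superset by (fastforce simp: push_pull_Suc)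
qed

text \<open>By the drift, the probabilities that \<open>u\<close> is uninformed at times before
  \<open>t\<close> sum to at most the initial distance. They decrease with time, so \<open>t\<close>
  times the last one is bounded as well.\<close>

lemma prob_uninformed_le:
  assumes "finite V" "\<And>x w. w \<in> nbrs E x \<Longrightarrow> w \<in> V" "\<And>x. finite (nbrs E x)" "route E v u c"
  shows "of_nat t * emeasure (push_pull V E t {v}) {I. u \<notin> I} \<le> of_nat c"
proof -
  let ?F = "\<lambda>t. \<integral>\<^sup>+I. of_nat (route_dist E I u) \<partial>push_pull V E t {v}"
  let ?p = "\<lambda>t. emeasure (push_pull V E t {v}) {I. u \<notin> I}"
  have p: "?p (Suc t) \<le> ?p t" for t
  proof -
    have "?p (Suc t) = (\<integral>\<^sup>+I. emeasure (push_pull_round V E I) {I. u \<notin> I} \<partial>push_pull V E t {v})"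
      by (simp add: push_pull_Suc flip: nn_integral_indicator)
    also have "\<dots> \<le> (\<integral>\<^sup>+I. indicator {I. u \<notin> I} I \<partial>push_pull V E t {v})"
    proof (intro nn_integral_mono)
      fix I :: "nat set"
      show "emeasure (push_pull_round V E I) {I. u \<notin> I} \<le> indicator {I. u \<notin> I} I"
      proof (cases "u \<in> I")
        case True
        then have "AE J in push_pull_round V E I. \<not> J \<in> {I. u \<notin> I}"
          by (auto simp: AE_measure_pmf_iff dest: subsetD[OF push_pull_round_superset])
        then have "emeasure (push_pull_round V E I) {I. u \<notin> I} = 0"
          by (subst (asm) AE_iff_measurable[where N="{I. u \<notin> I}"]) auto
        then show ?thesis by simp
      qed (simp add: measure_pmf.emeasure_le_1)
    qed
    finally show ?thesis by simp
  qed
  have F: "?F (Suc t) + ?p t \<le> ?F t" for t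
  proof -
    have "?F (Suc t) + ?p t = (\<integral>\<^sup>+I. (\<integral>\<^sup>+J. of_nat (route_dist E J u) \<partial>push_pull_round V E I)
        + indicator {I. u \<notin> I} I \<partial>push_pull V E t {v})"
      by (simp add: push_pull_Suc nn_integral_add)
    also have "\<dots> \<le> ?F t"
    proof (rule nn_integral_mono_AE, subst AE_measure_pmf_iff, rule ballI)
      fix I assume "I \<in> set_pmf (push_pull V E t {v})"
      then have "v \<in> I" using push_pull_superset by blast
      show "(\<integral>\<^sup>+J. of_nat (route_dist E J u) \<partial>push_pull_round V E I) + indicator {I. u \<notin> I} I
        \<le> of_nat (route_dist E I u)"
        by (rule route_dist_drift[OF assms(1) _ assms(3) \<open>v \<in> I\<close> assms(4)]) (rule assms(2))
    qed
    finally show ?thesis .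
  qed
  have "?F t + of_nat t * ?p t \<le> of_nat c"
  proof (induction t)
    case 0
    have "route_dist E {v} u \<le> c" using route_dist_le[OF _ assms(4)] by simp
    then show ?case by (simp add: push_pull_def)
  next
    case (Suc t)
    have "?F (Suc t) + of_nat (Suc t) * ?p (Suc t) \<le> ?F (Suc t) + of_nat (Suc t) * ?p t"
      by (intro add_left_mono mult_left_mono p) simp
    also have "\<dots> = (?F (Suc t) + ?p t) + of_nat t * ?p t" by (simp add: algebra_simps)
    also have "\<dots> \<le> ?F t + of_nat t * ?p t" by (intro add_right_mono F)
    finally show ?case using Suc.IH by (rule order_trans)
  qed
  moreover have "of_nat t * ?p t \<le> ?F t + of_nat t * ?p t" by (simp add: add_increasing)
  ultimately show ?thesis by (rule order_trans[rotated])
qed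

section \<open>Expectations over the process\<close>

text \<open>Parents and relays are read off the sequence of choices, so the randomness is placed on
  histories and projected to graphs afterwards.\<close>

fun history :: "nat \<Rightarrow> nat \<Rightarrow> nat set list pmf" where
  "history k 0 = return_pmf []"
| "history k (Suc t) = bind_pmf (history k t) (\<lambda>h. map_pmf (\<lambda>c. c # h) (pmf_of_set (active k h)))"

lemma active_nonempty: "valid k h \<Longrightarrow> k > 0 \<Longrightarrow> active k h \<noteq> {}"
  using card_active[of k h] by auto

lemma history_valid:
  assumes "k > 0" "h \<in> set_pmf (history k t)"
  shows "valid k h \<and> length h = t"
  using assms(2)
proof (induction t arbitrary: h)
  case (Suc t)
  then obtain h' c where h': "h' \<in> set_pmf (history k t)" "c \<in> set_pmf (pmf_of_set (active k h'))" "h = c # h'"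
    by auto
  have "valid k h'" "length h' = t" using Suc.IH[OF h'(1)] by auto
  then show ?case using h' finite_active[of k h'] active_nonempty[of k h'] assms(1) by simp
qed simp

lemma finite_history:
  assumes "k > 0"
  shows "finite (set_pmf (history k t))"
proof (induction t)
  case (Suc t)
  have "finite (set_pmf (pmf_of_set (active k h)))" if "h \<in> set_pmf (history k t)" for h
    using history_valid[OF assms that] finite_active active_nonempty assms by simp
  then show ?case using Suc by simp
qed simp

lemma apollonian_eq_history:
  assumes "k > 0"
  shows "apollonian k t = map_pmf (\<lambda>h. (edges k h, active k h)) (history k t)"
proof (induction t)
  case 0
  show ?case by (simp add: apollonian_init_def)
next
  case (Suc t)
  have "apollonian k (Suc t) = bind_pmf (history k t) (\<lambda>h. apollonian_step (k + t) (edges k h, active k h))"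
    by (simp add: Suc bind_map_pmf)
  also have "\<dots> = bind_pmf (history k t) (\<lambda>h. map_pmf (\<lambda>c. (edges k (c # h), active k (c # h))) (pmf_of_set (active k h)))"
    using history_valid[OF assms] by (intro bind_pmf_cong refl) (auto simp: apollonian_step_def)
  also have "\<dots> = map_pmf (\<lambda>h. (edges k h, active k h)) (history k (Suc t))"
    by (simp add: map_bind_pmf map_pmf_comp del: active.simps edges.simps)
  finally show ?case .
qed

lemma expectation_history_Suc:
  fixes F :: "nat set list \<Rightarrow> real"
  assumes "k > 0"
  shows "measure_pmf.expectation (history k (Suc t)) F =
    measure_pmf.expectation (history k t) (\<lambda>h. (\<Sum>c\<in>active k h. F (c # h)) / real (card (active k h)))"
proof -
  have "measure_pmf.expectation (history k (Suc t)) F = (\<Sum>h\<in>set_pmf (history k t).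
      pmf (history k t) h *\<^sub>R measure_pmf.expectation (map_pmf (\<lambda>c. c # h) (pmf_of_set (active k h))) F)"
    unfolding history.simps
    using finite_history[OF assms] history_valid[OF assms] finite_active active_nonempty assms
    by (intro pmf_expectation_bind) auto
  also have "\<dots> = (\<Sum>h\<in>set_pmf (history k t).
      pmf (history k t) h *\<^sub>R ((\<Sum>c\<in>active k h. F (c # h)) / real (card (active k h))))"
  proof (rule sum.cong[OF refl])
    fix h assume "h \<in> set_pmf (history k t)"
    then have "finite (active k h)" "active k h \<noteq> {}"
      using history_valid[OF assms] finite_active active_nonempty assms by auto
    then show "pmf (history k t) h *\<^sub>R measure_pmf.expectation (map_pmf (\<lambda>c. c # h) (pmf_of_set (active k h))) F =
      pmf (history k t) h *\<^sub>R ((\<Sum>c\<in>active k h. F (c # h)) / real (card (active k h)))"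
      by (simp add: integral_pmf_of_set)
  qed
  also have "\<dots> = measure_pmf.expectation (history k t) (\<lambda>h. (\<Sum>c\<in>active k h. F (c # h)) / real (card (active k h)))"
    by (rule integral_measure_pmf[symmetric]) (use finite_history[OF assms] in auto)
  finally show ?thesis .
qed

lemma expectation_history_mono:
  fixes F G :: "nat set list \<Rightarrow> real"
  assumes "k > 0" "\<And>h. valid k h \<Longrightarrow> length h = t \<Longrightarrow> F h \<le> G h"
  shows "measure_pmf.expectation (history k t) F \<le> measure_pmf.expectation (history k t) G"
  using assms(2) history_valid[OF assms(1)] finite_history[OF assms(1)]
  by (intro integral_mono_AE) (auto simp: AE_measure_pmf_iff intro!: integrable_measure_pmf_finite)

text \<open>The number \<open>a\<close> of active cliques grows exactly by the factor
  \<open>1 + (k - 1) / a\<close>. Hence the expectation divided by \<open>a\<close> rises in step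
  \<open>t + 1\<close> only by \<open>k\<close> over the new number of cliques, which is at least
  \<open>t + 1\<close>; this gives a harmonic sum.\<close>

lemma expectation_total_mass_le:
  assumes "k \<ge> 3"
  shows "measure_pmf.expectation (history k t) (total_mass k)
    \<le> real k * (1 + real (k - 1) * real t) * harm t"
proof (induction t)
  case 0
  show ?case by (simp add: total_mass_def harm_def)
next
  case (Suc t)
  let ?a = "1 + real (k - 1) * real t"
  let ?E = "measure_pmf.expectation (history k t)"
  have k: "k > 0" using assms by simp
  have int: "integrable (history k t) (F :: _ \<Rightarrow> real)" for F
    using finite_history[OF k] by (rule integrable_measure_pmf_finite)
  have "measure_pmf.expectation (history k (Suc t)) (total_mass k)
    \<le> ?E (\<lambda>h. (1 + real (k - 1) / ?a) * total_mass k h + real k)"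
    unfolding expectation_history_Suc[OF k]
  proof (rule expectation_history_mono[OF k])
    fix h assume h: "valid k h" "length h = t"
    have a: "real (card (active k h)) = ?a" using card_active[OF h(1) k] h(2) by simp
    show "(\<Sum>c\<in>active k h. total_mass k (c # h)) / real (card (active k h))
      \<le> (1 + real (k - 1) / ?a) * total_mass k h + real k"
      unfolding total_mass_drift[OF h(1) assms] a
      by (simp add: field_simps add_pos_nonneg add_nonneg_eq_0_iff)
  qed
  also have "\<dots> = (1 + real (k - 1) / ?a) * ?E (total_mass k) + real k"
    using int by simp
  also have "\<dots> \<le> (1 + real (k - 1) / ?a) * (real k * ?a * harm t) + real k"
    by (intro add_right_mono mult_left_mono Suc.IH) simp
  also have "\<dots> = real k * (?a + real (k - 1)) * harm t + real k"
  proof -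
    have "(1 + x / A) * (c * A * l) + z = c * (A + x) * l + z"
      if "A > 0" for A x z c l :: real using that by (simp add: field_simps)
    moreover have "?a > 0" by (simp add: add_pos_nonneg)
    ultimately show ?thesis by blast
  qed
  also have "\<dots> \<le> real k * (?a + real (k - 1)) * harm (Suc t)"
  proof -
    have "1 * real t \<le> real (k - 1) * real t" using assms by (intro mult_right_mono) auto
    then have "real (Suc t) \<le> ?a + real (k - 1)" using assms by linarith
    then have "1 \<le> (?a + real (k - 1)) * inverse (real (Suc t))" by (simp add: field_simps)
    then have "real k * 1 \<le> real k * ((?a + real (k - 1)) * inverse (real (Suc t)))"
      by (intro mult_left_mono) auto
    then show ?thesis by (simp add: harm_Suc ring_distribs mult.assoc)
  qed
  finally show ?case by (simp add: algebra_simps)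
qed

text \<open>The factor \<open>1 + (k - 2) / a\<close> falls short of the growth of \<open>a\<close>
  by \<open>1 / a\<close>. In the induction this leaves room \<open>?K * ?l\<close> per step, and
  \<open>?K\<close> is chosen so that the inhomogeneous terms fit into it. Fixing \<open>n\<close>
  keeps the logarithmic factor constant throughout.\<close>

lemma expectation_potential_le:
  assumes "k \<ge> 3" "t \<le> n"
  shows "measure_pmf.expectation (history k t) (potential k)
    \<le> (2 * real (k - 1)^2 * real k + real k ^ 2) * (1 + real (k - 1) * real t) * (1 + harm n)"
  using assms(2)
proof (induction t)
  case 0
  then show ?case using harm_nonneg[of n, where 'a=real] by (simp add: potential_def)
next
  case (Suc t)
  let ?a = "1 + real (k - 1) * real t"
  let ?K = "2 * real (k - 1)^2 * real k + real k ^ 2"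
  let ?l = "1 + harm n :: real"
  let ?E = "measure_pmf.expectation (history k t)"
  have k: "k > 0" using assms by simp
  have a0: "?a > 0" by (simp add: add_pos_nonneg)
  have l0: "?l \<ge> 0" "harm n \<ge> (0::real)" using harm_nonneg[of n, where 'a=real] by auto
  have int: "integrable (history k t) (F :: _ \<Rightarrow> real)" for F
    using finite_history[OF k] by (rule integrable_measure_pmf_finite)
  have "measure_pmf.expectation (history k (Suc t)) (potential k)
    \<le> ?E (\<lambda>h. (1 + real (k - 2) / ?a) * potential k h + 2 * real (k - 1)^2 / ?a * total_mass k h + real k ^ 2)"
    unfolding expectation_history_Suc[OF k]
  proof (rule expectation_history_mono[OF k])
    fix h assume h: "valid k h" "length h = t"
    have a: "real (card (active k h)) = ?a" using card_active[OF h(1) k] h(2) by simp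
    have "(\<Sum>c\<in>active k h. potential k (c # h)) / ?a \<le>
      ((?a + real (k - 2)) * potential k h + 2 * real (k - 1)^2 * total_mass k h + real k ^ 2 * ?a) / ?a"
      using potential_drift[OF h(1) assms(1)] a0 unfolding a by (intro divide_right_mono) auto
    also have "\<dots> = (1 + real (k - 2) / ?a) * potential k h + 2 * real (k - 1)^2 / ?a * total_mass k h + real k ^ 2"
    proof -
      have "((A + x) * P + y * Q + z * A) / A = (1 + x / A) * P + y / A * Q + z"
        if "A > 0" for A x y z P Q :: real using that by (simp add: field_simps)
      from this[OF a0] show ?thesis .
    qed
    finally show "(\<Sum>c\<in>active k h. potential k (c # h)) / real (card (active k h)) \<le>
      (1 + real (k - 2) / ?a) * potential k h + 2 * real (k - 1)^2 / ?a * total_mass k h + real k ^ 2"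
      unfolding a .
  qed
  also have "\<dots> = (1 + real (k - 2) / ?a) * ?E (potential k) + 2 * real (k - 1)^2 / ?a * ?E (total_mass k) + real k ^ 2"
    using int by simp
  also have "\<dots> \<le> (1 + real (k - 2) / ?a) * (?K * ?a * ?l)
      + 2 * real (k - 1)^2 / ?a * (real k * ?a * harm t) + real k ^ 2"
    using Suc a0 by (intro add_right_mono add_mono mult_left_mono expectation_total_mass_le assms(1)) auto
  also have "\<dots> = (?a + real (k - 2)) * ?K * ?l + 2 * real (k - 1)^2 * real k * harm t + real k ^ 2"
  proof -
    have "(1 + x / A) * (c * A * l) + y / A * (r * A * d) + z = (A + x) * c * l + y * r * d + z"
      if "A > 0" for A x y z c d l r :: real using that by (simp add: field_simps)
    from this[OF a0] show ?thesis .
  qed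
  also have "\<dots> \<le> (?a + real (k - 2)) * ?K * ?l + 2 * real (k - 1)^2 * real k * ?l + real k ^ 2 * ?l"
  proof -
    have "harm t \<le> (harm n :: real)" using Suc.prems by (intro harm_mono) simp
    then have "2 * real (k - 1)^2 * real k * harm t \<le> 2 * real (k - 1)^2 * real k * ?l"
      by (intro mult_left_mono) auto
    moreover have "real k ^ 2 * 1 \<le> real k ^ 2 * ?l" using l0 by (intro mult_left_mono) auto
    ultimately show ?thesis by simp
  qed
  also have "\<dots> = ?K * (?a + real (k - 1)) * ?l"
    using assms(1) by (simp add: of_nat_diff algebra_simps)
  finally show ?case by (simp add: algebra_simps)
qed

section \<open>From the potential to the number of uninformed vertices\<close>

lemma harm_le_ln: "n > 0 \<Longrightarrow> harm n \<le> 1 + ln (real n)"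
  using decseqD[OF decseq_harm_diff_ln, of 0 "n - 1"] by (simp add: harm_def)

text \<open>The \<open>k - 1\<close> oldest vertices, which are not in the tree, are counted as uninformed.\<close>

lemma expected_uninformed_le:
  assumes "valid k h" "k \<ge> 3" "T > 0"
  defines "V \<equiv> {0..<k + length h}"
  shows "(\<integral>\<^sup>+v. (\<integral>\<^sup>+I. of_nat (card (V - I)) \<partial>push_pull V (edges k h) T {v}) \<partial>pmf_of_set V)
    \<le> ennreal (2 * real k + 4 * potential k h / real T)"
proof -
  let ?E = "edges k h"
  let ?N = "real (k + length h)"
  let ?p = "\<lambda>v u. emeasure (push_pull V ?E T {v}) {I. u \<notin> I}"
  \<comment> \<open>The share of one endpoint in the failure probability. The value 1 outside the
    tree makes the bound trivial there.\<close>
  define b where "b v = (if v < k - 1 then 1 else real (climb k h v) / real T)" for v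
  have b0: "b v \<ge> 0" for v by (simp add: b_def)
  have p: "?p v u \<le> ennreal (b v + b u)" if "v \<in> V" "u \<in> V" for v u
  proof (cases "v < k - 1 \<or> u < k - 1")
    case True
    then have "1 \<le> b v + b u" using b0[of v] b0[of u] by (auto simp: b_def)
    then have "1 \<le> ennreal (b v + b u)" by simp
    then show ?thesis using measure_pmf.emeasure_le_1 order_trans by blast
  next
    case False
    then have vu: "v \<in> {k - 1..<k + length h}" "u \<in> {k - 1..<k + length h}"
      using that by (auto simp: V_def)
    obtain c where c: "c \<le> climb k h v" "route ?E v (k - 1) c" using route_root[OF assms(1,2) vu(1)] by blast
    obtain d where d: "d \<le> climb k h u" "route ?E u (k - 1) d" using route_root[OF assms(1,2) vu(2)] by blast
    \<comment> \<open>Climb from the source to the root and descend to the target along the reversed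
      route.\<close>
    have "route ?E v u (c + d)" using route_trans[OF c(2) route_sym[OF d(2)]] .
    then have "of_nat T * ?p v u \<le> of_nat (c + d)"
      by (rule prob_uninformed_le[rotated -1])
        (use nbrs_range[OF assms(1)] finite_nbrs[OF assms(1)] in \<open>auto simp: V_def\<close>)
    also have "\<dots> \<le> of_nat (climb k h v + climb k h u)" using c d by (intro of_nat_mono add_mono)
    finally have "real T * measure (push_pull V ?E T {v}) {I. u \<notin> I} \<le> real (climb k h v + climb k h u)"
      by (simp add: measure_pmf.emeasure_eq_measure ennreal_of_nat_eq_real_of_nat flip: ennreal_mult ennreal_plus)
    then have "measure (push_pull V ?E T {v}) {I. u \<notin> I} \<le> b v + b u"
      using assms(3) False by (simp add: b_def field_simps)
    then show ?thesis unfolding measure_pmf.emeasure_eq_measure by (rule ennreal_leI)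
  qed
  have V: "finite V" "V \<noteq> {}" "real (card V) = ?N" using assms(2) by (auto simp: V_def)
  have unif: "(\<integral>\<^sup>+I. of_nat (card (V - I)) \<partial>push_pull V ?E T {v}) \<le> ennreal (\<Sum>u\<in>V. b v + b u)"
    if "v \<in> V" for v
  proof -
    have "of_nat (card (V - I)) = (\<Sum>u\<in>V. indicator {I. u \<notin> I} I :: ennreal)" for I
      using V(1) by (simp add: indicator_def Diff_eq Int_def sum.If_cases)
    then have "(\<integral>\<^sup>+I. of_nat (card (V - I)) \<partial>push_pull V ?E T {v}) = (\<Sum>u\<in>V. ?p v u)"
      by (simp add: nn_integral_sum)
    also have "\<dots> \<le> (\<Sum>u\<in>V. ennreal (b v + b u))" using p that by (intro sum_mono) auto
    also have "\<dots> = ennreal (\<Sum>u\<in>V. b v + b u)" using b0 by (intro sum_ennreal) (simp add: add_nonneg_nonneg)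
    finally show ?thesis .
  qed
  have sum_b: "(\<Sum>v\<in>V. b v) \<le> real k + 2 * potential k h / real T"
  proof -
    have "V = {0..<k - 1} \<union> {k - 1..<k + length h}" using assms(2) by (auto simp: V_def)
    then have "(\<Sum>v\<in>V. b v) = (\<Sum>v\<in>{0..<k - 1}. b v) + (\<Sum>v = k - 1..<k + length h. b v)"
      by (simp add: sum.union_disjoint)
    also have "\<dots> = real (k - 1) + (\<Sum>v = k - 1..<k + length h. real (climb k h v)) / real T"
      by (simp add: b_def sum_divide_distrib)
    also have "\<dots> \<le> real k + 2 * potential k h / real T"
      using sum_climb_le[OF assms(1,2)] by (intro add_mono divide_right_mono) auto
    finally show ?thesis .
  qed
  have "(\<integral>\<^sup>+v. (\<integral>\<^sup>+I. of_nat (card (V - I)) \<partial>push_pull V ?E T {v}) \<partial>pmf_of_set V)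
    \<le> (\<integral>\<^sup>+v. ennreal (\<Sum>u\<in>V. b v + b u) \<partial>pmf_of_set V)"
    by (rule nn_integral_mono_AE) (use unif V in \<open>simp add: AE_measure_pmf_iff\<close>)
  also have "\<dots> = ennreal (measure_pmf.expectation (pmf_of_set V) (\<lambda>v. \<Sum>u\<in>V. b v + b u))"
    using V b0 by (intro nn_integral_eq_integral integrable_measure_pmf_finite AE_I2)
      (auto intro!: sum_nonneg add_nonneg_nonneg)
  \<comment> \<open>Source and target each contribute one copy of the sum: the number of targets
    cancels against the uniform choice of the source.\<close>
  also have "measure_pmf.expectation (pmf_of_set V) (\<lambda>v. \<Sum>u\<in>V. b v + b u) = 2 * (\<Sum>v\<in>V. b v)"
  proof -
    have "(\<Sum>v\<in>V. \<Sum>u\<in>V. b v + b u) = 2 * (real (card V) * (\<Sum>v\<in>V. b v))"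
      by (simp add: sum.distrib flip: sum_distrib_left)
    then show ?thesis using V(1,2) by (simp add: integral_pmf_of_set)
  qed
  also have "ennreal (2 * (\<Sum>v\<in>V. b v)) \<le> ennreal (2 * real k + 4 * potential k h / real T)"
    using sum_b by (intro ennreal_leI) simp
  finally show ?thesis .
qed

lemma expected_uninformed_rumor_le:
  assumes "k \<ge> 3" "T > 0" "n > 0"
  shows "(\<integral>\<^sup>+I. of_nat (card ({0..<n + k} - I)) \<partial>apollonian_rumor k n T) \<le>
    ennreal (2 * real k + 4 * ((2 * real (k - 1)^2 * real k + real k ^ 2)
      * (1 + real (k - 1) * real n) * (2 + ln (real n))) / real T)"
proof -
  have k: "k > 0" using assms by simp
  let ?V = "{0..<n + k}"
  let ?K = "2 * real (k - 1)^2 * real k + real k ^ 2"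
  have pot0: "potential k h \<ge> 0" for h by (simp add: potential_def sum_nonneg)
  have "(\<integral>\<^sup>+I. of_nat (card (?V - I)) \<partial>apollonian_rumor k n T) =
    (\<integral>\<^sup>+h. (\<integral>\<^sup>+v. (\<integral>\<^sup>+I. of_nat (card (?V - I)) \<partial>push_pull ?V (edges k h) T {v}) \<partial>pmf_of_set ?V) \<partial>history k n)"
    by (simp add: apollonian_rumor_def apollonian_network_def apollonian_eq_history[OF k] map_pmf_comp)
  also have "\<dots> \<le> (\<integral>\<^sup>+h. ennreal (2 * real k + 4 * potential k h / real T) \<partial>history k n)"
  proof (rule nn_integral_mono_AE, subst AE_measure_pmf_iff, rule ballI)
    fix h assume "h \<in> set_pmf (history k n)"
    then have h: "valid k h" "length h = n" using history_valid[OF k] by auto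
    show "(\<integral>\<^sup>+v. (\<integral>\<^sup>+I. of_nat (card (?V - I)) \<partial>push_pull ?V (edges k h) T {v}) \<partial>pmf_of_set ?V)
      \<le> ennreal (2 * real k + 4 * potential k h / real T)"
      using expected_uninformed_le[OF h(1) assms(1,2)] by (simp add: h(2) add.commute)
  qed
  also have "\<dots> = ennreal (measure_pmf.expectation (history k n) (\<lambda>h. 2 * real k + 4 * potential k h / real T))"
    using finite_history[OF k] pot0
    by (intro nn_integral_eq_integral integrable_measure_pmf_finite AE_I2) auto
  also have "measure_pmf.expectation (history k n) (\<lambda>h. 2 * real k + 4 * potential k h / real T)
    = 2 * real k + 4 * measure_pmf.expectation (history k n) (potential k) / real T"
    using finite_history[OF k] by (simp add: integrable_measure_pmf_finite)
  also have "ennreal \<dots> \<le> ennreal (2 * real k + 4 * (?K * (1 + real (k - 1) * real n) * (2 + ln (real n))) / real T)"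
  proof -
    have "measure_pmf.expectation (history k n) (potential k) \<le> ?K * (1 + real (k - 1) * real n) * (1 + harm n)"
      by (rule expectation_potential_le[OF assms(1) order_refl])
    also have "\<dots> \<le> ?K * (1 + real (k - 1) * real n) * (2 + ln (real n))"
      using harm_le_ln[OF assms(3)] by (intro mult_left_mono) auto
    finally show ?thesis by (intro ennreal_leI add_left_mono divide_right_mono mult_left_mono) auto
  qed
  finally show ?thesis .
qed

text \<open>Guards against \<open>card\<close> being 0 on an infinite set when informed vertices are
  counted.\<close>

lemma finite_push_pull:
  assumes "finite V" "finite I" "J \<in> set_pmf (push_pull V E t I)"
  shows "finite J"
  using assms(3)
proof (induction t arbitrary: J)
  case 0
  then show ?case using assms(2) by (simp add: push_pull_def)
next
  case (Suc t)
  then obtain I' where "finite I'" "J \<in> set_pmf (push_pull_round V E I')"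
    by (auto simp: push_pull_Suc)
  then show ?case using assms(1) by (auto simp: push_pull_round_def)
qed

text \<open>Markov's inequality for the number of uninformed vertices with threshold
  \<open>g\<close>.\<close>

lemma prob_informed_ge:
  assumes "k > 0" "g > 0" "B \<ge> 0"
    and "(\<integral>\<^sup>+I. of_nat (card ({0..<n + k} - I)) \<partial>apollonian_rumor k n T) \<le> ennreal B"
  shows "1 - B / g \<le> measure_pmf.prob (apollonian_rumor k n T) {I. real (card I) \<ge> real n - g}"
proof -
  let ?M = "apollonian_rumor k n T" and ?V = "{0..<n + k}"
  let ?X = "\<lambda>I. of_nat (card (?V - I)) :: ennreal"
  let ?bad = "{I. g \<le> real (card (?V - I))}"
  have "emeasure ?M ?bad = emeasure ?M {I\<in>space ?M. 1 \<le> ennreal (1 / g) * ?X I}"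
    using assms(2) by (intro arg_cong2[where f=emeasure] refl)
      (auto simp: ennreal_of_nat_eq_real_of_nat field_simps simp flip: ennreal_mult)
  also have "\<dots> \<le> ennreal (1 / g) * (\<integral>\<^sup>+I. ?X I \<partial>?M)"
    using nn_integral_Markov_inequality[of ?X UNIV "measure_pmf ?M" "ennreal (1 / g)"] by simp
  also have "\<dots> \<le> ennreal (1 / g) * ennreal B" by (intro mult_left_mono assms(4)) simp
  also have "\<dots> = ennreal (B / g)" using assms by (simp flip: ennreal_mult)
  finally have bad: "measure_pmf.prob ?M ?bad \<le> B / g"
    using assms by (simp add: measure_pmf.emeasure_eq_measure)
  have "1 - measure_pmf.prob ?M ?bad = measure_pmf.prob ?M (- ?bad)"
    using measure_pmf.prob_compl[of ?bad ?M] by (simp add: Compl_eq_Diff_UNIV)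
  also have "\<dots> \<le> measure_pmf.prob ?M {I. real (card I) \<ge> real n - g}"
  proof (rule measure_pmf.finite_measure_mono_AE)
    show "AE I in ?M. I \<in> - ?bad \<longrightarrow> I \<in> {I. real n - g \<le> real (card I)}"
    proof (subst AE_measure_pmf_iff, intro ballI impI)
      fix I assume I: "I \<in> set_pmf ?M" "I \<in> - ?bad"
      then have fin: "finite I" by (auto simp: apollonian_rumor_def dest!: finite_push_pull[rotated -1])
      have "card ?V \<le> card ((?V - I) \<union> I)" using fin by (intro card_mono) auto
      also have "\<dots> \<le> card (?V - I) + card I" by (rule card_Un_le)
      finally have "real (n + k) \<le> real (card (?V - I)) + real (card I)" by simp
      then show "I \<in> {I. real n - g \<le> real (card I)}" using I(2) by simp
    qed
  qed simp
  finally show ?thesis using bad by linarith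
qed

theorem theorem3:
  fixes k :: nat and f :: "nat \<Rightarrow> real"
  assumes "k \<ge> 3"
    and "f \<in> o(\<lambda>n. ln (ln (real n)))"
    and "filterlim f at_top at_top"
  shows "\<exists>C > 0. \<exists>g :: nat \<Rightarrow> real. g \<in> o(\<lambda>n. real n) \<and>
    ((\<lambda>n. measure_pmf.prob
        (apollonian_rumor k n
          (nat \<lceil>C * ln (real n) powr ((real k ^ 2 - 3) / (real k - 1) ^ 2)
                 * ln (ln (real n)) * f n powr (2 / real k)\<rceil>))
        {I. real (card I) \<ge> real n - g n})
      \<longlonglongrightarrow> 1)"
proof -
  let ?e = "(real k ^ 2 - 3) / (real k - 1) ^ 2"
  \<comment> \<open>The constant \<open>C\<close> is 1: the factor \<open>ln (ln n)\<close> tends to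
    infinity and absorbs all constants in the \<open>O(log n)\<close> bound.\<close>
  define T where "T n = nat \<lceil>1 * ln (real n) powr ?e * ln (ln (real n)) * f n powr (2 / real k)\<rceil>" for n
  define K where "K = 2 * real (k - 1)^2 * real k + real k ^ 2"
  \<comment> \<open>Bounds the expected uninformed fraction, from
    \<open>T n \<ge> ln n * ln (ln n)\<close> and
    \<open>1 + (k - 1) * n \<le> k * n\<close>.\<close>
  define s where "s n = 2 * real k / real n
    + 4 * K * real k * (2 + ln (real n)) / (ln (real n) * ln (ln (real n)))" for n
  \<comment> \<open>The square root balances the two requirements: \<open>g n / n\<close> and the
    failure probability \<open>n * s n / g n\<close> both equal \<open>sqrt (s n)\<close>.\<close>
  define g where "g n = real n * sqrt (s n)" for n
  have K: "K \<ge> 0" by (simp add: K_def)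
  have e: "?e \<ge> 1"
  proof -
    have "(real k - 1)^2 \<le> real k ^ 2 - 3" using assms(1) by (simp add: power2_eq_square algebra_simps)
    then show ?thesis using assms(1) by (simp add: field_simps)
  qed
  have "(\<lambda>n. 2 * real k / real n) \<longlonglongrightarrow> 0" by real_asymp
  moreover have "(\<lambda>n. (2 + ln (real n)) / (ln (real n) * ln (ln (real n)))) \<longlonglongrightarrow> 0" by real_asymp
  then have "(\<lambda>n. 4 * K * real k * ((2 + ln (real n)) / (ln (real n) * ln (ln (real n))))) \<longlonglongrightarrow> 4 * K * real k * 0"
    by (rule tendsto_mult_left)
  ultimately have s: "s \<longlonglongrightarrow> 0" unfolding s_def using tendsto_add by fastforce
  then have sqrt_s: "(\<lambda>n. sqrt (s n)) \<longlonglongrightarrow> 0" using tendsto_real_sqrt by fastforce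
  have g: "g \<in> o(\<lambda>n. real n)"
  proof (rule smalloI_tendsto)
    show "(\<lambda>n. g n / real n) \<longlonglongrightarrow> 0"
      by (rule Lim_transform_eventually[OF sqrt_s])
        (use eventually_gt_at_top[of 0] in eventually_elim, simp add: g_def)
    show "\<forall>\<^sub>F n in sequentially. real n \<noteq> 0" using eventually_gt_at_top[of 0] by eventually_elim simp
  qed
  have "\<forall>\<^sub>F n in sequentially. f n \<ge> 1" using assms(3) by (simp add: filterlim_at_top)
  moreover have "\<forall>\<^sub>F n in sequentially. ln (real n) \<ge> 1" by real_asymp
  moreover have "\<forall>\<^sub>F n in sequentially. ln (ln (real n)) > 0" by real_asymp
  moreover have "\<forall>\<^sub>F n in sequentially. n > 0" by (rule eventually_gt_at_top)
  ultimately have ev: "\<forall>\<^sub>F n in sequentially. 1 - sqrt (s n)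
      \<le> measure_pmf.prob (apollonian_rumor k n (T n)) {I. real (card I) \<ge> real n - g n}"
  proof eventually_elim
    case (elim n)
    let ?L = "ln (real n)"
    let ?B = "2 * real k + 4 * (K * (1 + real (k - 1) * real n) * (2 + ?L)) / real (T n)"
    have L: "?L * ln ?L > 0" using elim by (intro mult_pos_pos) linarith+
    \<comment> \<open>As the exponent is at least 1 and eventually \<open>f n \<ge> 1\<close>, the
      number of rounds is at least \<open>ln n * ln (ln n)\<close>.\<close>
    have "?L * ln ?L * 1 \<le> ?L powr ?e * ln ?L * f n powr (2 / real k)"
    proof (intro mult_mono)
      show "?L \<le> ?L powr ?e" using powr_mono[OF e elim(2)] elim(2) by simp
      show "1 \<le> f n powr (2 / real k)" using elim(1) by (intro ge_one_powr_ge_zero) auto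
    qed (use elim in auto)
    also have "\<dots> \<le> real (T n)" unfolding T_def by (simp add: real_nat_ceiling_ge)
    finally have T: "?L * ln ?L \<le> real (T n)" by simp
    then have T0: "T n > 0" using L by simp
    have "1 + real (k - 1) * real n \<le> real n + real (k - 1) * real n" using elim by simp
    also have "\<dots> = real k * real n" using assms(1) by (simp add: of_nat_diff algebra_simps)
    finally have "4 * (K * (1 + real (k - 1) * real n) * (2 + ?L)) / real (T n)
      \<le> 4 * (K * (real k * real n) * (2 + ?L)) / (?L * ln ?L)"
      using K elim L T by (intro frac_le mult_left_mono mult_right_mono) auto
    then have "?B \<le> 2 * real k + 4 * (K * (real k * real n) * (2 + ?L)) / (?L * ln ?L)" by simp
    also have "\<dots> = real n * s n" using elim by (simp add: s_def field_simps)
    finally have B: "?B \<le> real n * s n" .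
    have s0: "s n > 0"
      unfolding s_def using elim assms(1) K by (intro add_pos_nonneg) auto
    then have g0: "g n > 0" using elim by (simp add: g_def)
    have "(\<integral>\<^sup>+I. of_nat (card ({0..<n + k} - I)) \<partial>apollonian_rumor k n (T n)) \<le> ennreal ?B"
      using expected_uninformed_rumor_le[OF assms(1) T0 elim(4)] by (simp only: K_def)
    also have "\<dots> \<le> ennreal (real n * s n)" using B by (rule ennreal_leI)
    finally have "1 - (real n * s n) / g n
      \<le> measure_pmf.prob (apollonian_rumor k n (T n)) {I. real (card I) \<ge> real n - g n}"
      using assms(1) g0 s0 by (intro prob_informed_ge) auto
    moreover have "(real n * s n) / g n = sqrt (s n)" using s0 elim by (simp add: g_def real_div_sqrt)
    ultimately show ?case by simp
  qed
  have "(\<lambda>n. measure_pmf.prob (apollonian_rumor k n (T n)) {I. real (card I) \<ge> real n - g n}) \<longlonglongrightarrow> 1"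
  proof (rule tendsto_sandwich[OF ev])
    show "(\<lambda>n. 1 - sqrt (s n)) \<longlonglongrightarrow> 1" using tendsto_diff[OF tendsto_const[of 1] sqrt_s] by simp
  qed auto
  then show ?thesis using g unfolding T_def by (intro exI[of _ 1] conjI exI[of _ g]) auto
qed

end
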